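(* Let $(\xi_k)_{k\in\mathbb{Z}}$ be a sequence of independent random variables with $\xi_k\sim Ber(\frac12)$ for all $k\in\mathbb{Z}$. Then the stationary process $X_t=\sum_{j=0}^\infty 2^{-j-1}\xi_{t-j}$, $t\in\mathbb{Z}$, is $\theta$-lex-weakly dependent but neither $\alpha$-mixing nor $\alpha_{\infty,1}$-mixing.
   Context: For a process $X=(X_t)_{t\in\mathbb{Z}}$ put $V_j^h=\{s\in\mathbb{Z}: s\le j,\ |j-s|\ge h\}$. Let $\mathcal{G}^*_u$ be the bounded Borel functions $\mathbb{R}^u\to\mathbb{R}$ and $\mathcal{G}_1$ the bounded (globally) Lipschitz functions $\mathbb{R}\to\mathbb{R}$, with Lipschitz constant $Lip(G)$; $X_\Gamma=(X_{i_1},\dots,X_{i_u})$ for $\Gamma=(i_1,\dots,i_u)$. $X$ is $\theta$-lex-weakly dependent if $\theta(h)=\sup_{u\in\mathbb{N}}\theta_u(h)\to0$ as $h\to\infty$, where $$\theta_u(h)=\sup\Big\{\frac{|Cov(F(X_\Gamma),G(X_j))|}{\|F\|_\infty Lip(G)}: F\in\mathcal{G}_u^*,\,G\in\mathcal{G}_1,\,j\in\mathbb{Z},\,\Gamma\subset V_j^h,\,|\Gamma|=u\Big\}$$ (supremum over $F,G$ with non-zero denominator). For sub-$\sigma$-algebras $\mathcal{M},\mathcal{V}$, $\alpha(\mathcal{M},\mathcal{V})=\sup\{|P(M)P(V)-P(M\cap V)|: M\in\mathcal{M},V\in\mathcal{V}\}$. $X$ is $\alpha$-mixing if $\alpha(h)=\alpha(\sigma(\{X_s,s\le0\}),\sigma(\{X_s,s\ge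 h\}))\to0$ as $h\to\infty$; $X$ is $\alpha_{\infty,1}$-mixing if $$\alpha_{\infty,1}(h)=\sup\{\alpha(\sigma(X_\Gamma),\sigma(X_{\tilde\Gamma})):\Gamma,\tilde\Gamma\subset\mathbb{Z},\ |\tilde\Gamma|\le 1,\ dist(\Gamma,\tilde\Gamma)\ge h\}\to0$$ as $h\to\infty$, where $\Gamma$ may be infinite. *)

theory Defs
  imports "HOL-Probability.Probability"
begin

text \<open>Processes are families \<open>X :: int \<Rightarrow> 'a \<Rightarrow> real\<close> of random variables on a probability
  space \<open>M\<close>.\<close>

definition strictly_stationary :: "'a measure \<Rightarrow> (int \<Rightarrow> 'a \<Rightarrow> real) \<Rightarrow> bool" where
  "strictly_stationary M X \<longleftrightarrow>
     (\<forall>t. X t \<in> borel_measurable M) \<and>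
     (\<forall>I k. finite I \<longrightarrow>
        distr M (\<Pi>\<^sub>M i\<in>I. borel) (\<lambda>\<omega>. \<lambda>i\<in>I. X (i + k) \<omega>) =
        distr M (\<Pi>\<^sub>M i\<in>I. borel) (\<lambda>\<omega>. \<lambda>i\<in>I. X i \<omega>))"

definition covariance :: "'a measure \<Rightarrow> ('a \<Rightarrow> real) \<Rightarrow> ('a \<Rightarrow> real) \<Rightarrow> real" where
  "covariance M Y Z =
     (\<integral>\<omega>. (Y \<omega> - (\<integral>\<omega>'. Y \<omega>' \<partial>M)) * (Z \<omega> - (\<integral>\<omega>'. Z \<omega>' \<partial>M)) \<partial>M)"


subsection \<open>Weak dependence\<close>

definition past_set :: "int \<Rightarrow> nat \<Rightarrow> int set" where
  "past_set j h = {s. s \<le> j \<and> \<bar>j - s\<bar> \<ge> int h}"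

text \<open>Since \<open>u\<close> is quantified inside the definitions below, the space of real \<open>u\<close>-tuples is
  rendered as the product space over the index set \<open>{..<u}\<close>, whose points are the extensional
  functions on \<open>{..<u}\<close> and whose sigma-algebra is the Borel one.\<close>

abbreviation tuple_space :: "nat \<Rightarrow> (nat \<Rightarrow> real) measure" where
  "tuple_space u \<equiv> (\<Pi>\<^sub>M i\<in>{..<u}. borel)"

definition bounded_borel :: "nat \<Rightarrow> ((nat \<Rightarrow> real) \<Rightarrow> real) set" where
  "bounded_borel u =
     {F \<in> borel_measurable (tuple_space u). bounded (F ` space (tuple_space u))}"

definition sup_norm :: "nat \<Rightarrow> ((nat \<Rightarrow> real) \<Rightarrow> real) \<Rightarrow> real" where
  "sup_norm u F = (SUP x\<in>space (tuple_space u). \<bar>F x\<bar>)"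

definition bounded_lipschitz :: "(real \<Rightarrow> real) set" where
  "bounded_lipschitz = {G. bounded (range G) \<and> (\<exists>L. L-lipschitz_on UNIV G)}"

definition Lip :: "(real \<Rightarrow> real) \<Rightarrow> real" where
  "Lip G = Sup {\<bar>G x - G y\<bar> / \<bar>x - y\<bar> | x y. x \<noteq> y}"

definition subvector :: "(int \<Rightarrow> 'a \<Rightarrow> real) \<Rightarrow> int list \<Rightarrow> 'a \<Rightarrow> nat \<Rightarrow> real" where
  "subvector X \<Gamma> \<omega> = (\<lambda>k\<in>{..<length \<Gamma>}. X (\<Gamma> ! k) \<omega>)"

text \<open>The coefficients take values in the extended nonnegative reals, so that the suprema are
  meaningful for every process.\<close>

definition theta_tuple :: "'a measure \<Rightarrow> (int \<Rightarrow> 'a \<Rightarrow> real) \<Rightarrow> nat \<Rightarrow> nat \<Rightarrow> ennreal" where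
  "theta_tuple M X u h =
     Sup {ennreal (\<bar>covariance M (\<lambda>\<omega>. F (subvector X \<Gamma> \<omega>)) (\<lambda>\<omega>. G (X j \<omega>))\<bar>
                     / (sup_norm u F * Lip G)) | F G j \<Gamma>.
            F \<in> bounded_borel u \<and> G \<in> bounded_lipschitz \<and> sup_norm u F * Lip G \<noteq> 0 \<and>
            distinct \<Gamma> \<and> length \<Gamma> = u \<and> set \<Gamma> \<subseteq> past_set j h}"

definition theta :: "'a measure \<Rightarrow> (int \<Rightarrow> 'a \<Rightarrow> real) \<Rightarrow> nat \<Rightarrow> ennreal" where
  "theta M X h = (SUP u\<in>{1..}. theta_tuple M X u h)"

definition theta_lex_weakly_dependent :: "'a measure \<Rightarrow> (int \<Rightarrow> 'a \<Rightarrow> real) \<Rightarrow> bool" where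
  "theta_lex_weakly_dependent M X \<longleftrightarrow> theta M X \<longlonglongrightarrow> 0"


subsection \<open>Mixing\<close>

text \<open>Sub-sigma-algebras are represented by their sets of events.\<close>

definition alpha_coeff :: "'a measure \<Rightarrow> 'a set set \<Rightarrow> 'a set set \<Rightarrow> real" where
  "alpha_coeff M \<A> \<B> =
     Sup {\<bar>measure M A * measure M B - measure M (A \<inter> B)\<bar> | A B. A \<in> \<A> \<and> B \<in> \<B>}"

definition generated_events :: "'a measure \<Rightarrow> (int \<Rightarrow> 'a \<Rightarrow> real) \<Rightarrow> int set \<Rightarrow> 'a set set" where
  "generated_events M X S =
     sigma_sets (space M) {X s -` B \<inter> space M | s B. s \<in> S \<and> B \<in> sets borel}"

definition alpha_mixing_coeff :: "'a measure \<Rightarrow> (int \<Rightarrow> 'a \<Rightarrow> real) \<Rightarrow> nat \<Rightarrow> real" where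
  "alpha_mixing_coeff M X h =
     alpha_coeff M (generated_events M X {s. s \<le> 0}) (generated_events M X {s. s \<ge> int h})"

definition alpha_mixing :: "'a measure \<Rightarrow> (int \<Rightarrow> 'a \<Rightarrow> real) \<Rightarrow> bool" where
  "alpha_mixing M X \<longleftrightarrow> alpha_mixing_coeff M X \<longlonglongrightarrow> 0"

text \<open>The distance to the empty set is infinite.\<close>

definition index_dist :: "int set \<Rightarrow> int set \<Rightarrow> enat" where
  "index_dist \<Gamma> \<Gamma>' = (INF s\<in>\<Gamma>. INF t\<in>\<Gamma>'. enat (nat \<bar>s - t\<bar>))"

definition alpha_inf_1_coeff :: "'a measure \<Rightarrow> (int \<Rightarrow> 'a \<Rightarrow> real) \<Rightarrow> nat \<Rightarrow> real" where
  "alpha_inf_1_coeff M X h =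
     Sup {alpha_coeff M (generated_events M X \<Gamma>) (generated_events M X \<Gamma>') | \<Gamma> \<Gamma>'.
            finite \<Gamma>' \<and> card \<Gamma>' \<le> 1 \<and> index_dist \<Gamma> \<Gamma>' \<ge> enat h}"

definition alpha_inf_1_mixing :: "'a measure \<Rightarrow> (int \<Rightarrow> 'a \<Rightarrow> real) \<Rightarrow> bool" where
  "alpha_inf_1_mixing M X \<longleftrightarrow> alpha_inf_1_coeff M X \<longlonglongrightarrow> 0"

end

theory Submission
  imports Defs
begin

text \<open>
  Almost surely, \<open>X\<^sub>t\<close> is the number in \<open>[0, 1]\<close> with binary digits
  \<open>\<xi>\<^sub>t, \<xi>\<^sub>t\<^sub>-\<^sub>1, \<dots>\<close>. Everything rests on cutting this expansion after \<open>h\<close> digits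
  (\<open>binary_value_split\<close>):
  \<open>X\<^sub>t = S + X\<^sub>t\<^sub>-\<^sub>h / 2 ^ h\<close>, where \<open>S\<close> is a function of the \<open>h\<close> most recent digits and
  \<open>2 ^ h * S\<close> is an integer.

  \<^item> For a Lipschitz function the second term is negligible. \<open>G (X\<^sub>t)\<close> is within \<open>Lip G / 2 ^ h\<close> of
    \<open>G S\<close>, and \<open>S\<close> is independent of all values of the process up to time \<open>t - h\<close>. Hence the
    covariance with a bounded function \<open>F\<close> of these values is at most
    \<open>2 * \<parallel>F\<parallel> * Lip G / 2 ^ h\<close> (\<open>covariance_past_le\<close>), which bounds \<open>\<theta>(h)\<close> by \<open>2 / 2 ^ h\<close>.

  \<^item> For a measurable function it is not negligible at all. Since \<open>2 ^ h * S\<close> is an integer,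
    \<open>X\<^sub>h\<close> determines \<open>X\<^sub>0\<close> modulo 1: \<open>frac (2 ^ h * X\<^sub>h) = frac X\<^sub>0\<close>. So a nontrivial event
    about \<open>X\<^sub>0\<close> recurs, up to a null set, as an event about \<open>X\<^sub>h\<close> (\<open>exists_common_event\<close>), and
    such an event keeps both mixing coefficients above a positive constant for every \<open>h\<close>. Both
    coefficients see it, because both compare a sigma-algebra containing \<open>\<sigma>(X\<^sub>0)\<close> with one
    containing \<open>\<sigma>(X\<^sub>h)\<close>.

  Stationarity holds because \<open>X\<^sub>t\<close> is the same function of the shifted digits for every \<open>t\<close>, and the
  joint law of the digits, an infinite power of one distribution, is invariant under shifts.
\<close>

section \<open>Binary expansions\<close>

definition binary_value :: "(int \<Rightarrow> real) \<Rightarrow> int \<Rightarrow> real" where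
  "binary_value b t = (\<Sum>j. b (t - int j) / 2 ^ (j + 1))"

definition leading_part :: "nat \<Rightarrow> (int \<Rightarrow> real) \<Rightarrow> int \<Rightarrow> real" where
  "leading_part h b t = (\<Sum>j<h. b (t - int j) / 2 ^ (j + 1))"

text \<open>
  \<^term>\<open>binary_value b (t - int h)\<close> and \<^term>\<open>leading_part h b t\<close> read disjoint sets of digits.
  This locality, in the form of congruences and of measurability on restricted index sets, is the
  source of all independence below.
\<close>

lemma binary_value_cong:
  assumes "\<And>k. k \<le> t \<Longrightarrow> b k = c k"
  shows "binary_value b t = binary_value c t"
  using assms by (simp add: binary_value_def)

lemma leading_part_cong:
  assumes "\<And>k. \<lbrakk>t - int h < k; k \<le> t\<rbrakk> \<Longrightarrow> b k = c k"
  shows "leading_part h b t = leading_part h c t"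
  using assms by (simp add: leading_part_def)

lemma binary_value_shift: "binary_value (\<lambda>m. b (m + k)) t = binary_value b (t + k)"
  by (simp add: binary_value_def algebra_simps)

lemma measurable_binary_value:
  assumes "{..t} \<subseteq> K"
  shows "(\<lambda>x. binary_value x t) \<in> borel_measurable (\<Pi>\<^sub>M k\<in>K. borel)"
proof -
  have [measurable]: "(\<lambda>x. x (t - int j)) \<in> borel_measurable (\<Pi>\<^sub>M k\<in>K. (borel :: real measure))" for j
    using assms by (intro measurable_component_singleton) auto
  show ?thesis unfolding binary_value_def by measurable
qed

lemma measurable_leading_part:
  assumes "{t - int h<..t} \<subseteq> K"
  shows "(\<lambda>x. leading_part h x t) \<in> borel_measurable (\<Pi>\<^sub>M k\<in>K. borel)"
  unfolding leading_part_def
proof (rule borel_measurable_sum)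
  fix j assume "j \<in> {..<h}"
  then have [measurable]: "(\<lambda>x. x (t - int j)) \<in> borel_measurable (\<Pi>\<^sub>M k\<in>K. (borel :: real measure))"
    using assms by (intro measurable_component_singleton) auto
  show "(\<lambda>x. x (t - int j) / 2 ^ (j + 1)) \<in> borel_measurable (\<Pi>\<^sub>M k\<in>K. (borel :: real measure))"
    by measurable
qed

context
  fixes b :: "int \<Rightarrow> real"
  assumes bits: "\<And>k. b k \<in> {0, 1}"
begin

lemma summable_bits: "summable (\<lambda>j. b (t - int j) / 2 ^ (j + 1))"
proof (rule summable_comparison_test')
  show "summable (\<lambda>j. (1/2::real) ^ j)" by (simp add: summable_geometric)
  fix j :: nat assume "j \<ge> 0"
  have "b (t - int j) = 0 \<or> b (t - int j) = 1" using bits by blast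
  then show "norm (b (t - int j) / 2 ^ (j + 1)) \<le> (1/2) ^ j"
    by (auto simp: field_simps)
qed

lemma binary_value_bounds: "0 \<le> binary_value b t" "binary_value b t \<le> 1"
proof -
  have b01: "0 \<le> b k" "b k \<le> 1" for k
    using bits[of k] by auto
  show "0 \<le> binary_value b t"
    unfolding binary_value_def by (intro suminf_nonneg summable_bits) (simp add: b01)
  have "(\<lambda>j. (1/2::real) ^ Suc j) sums 1" by (rule power_half_series)
  then have S: "(\<lambda>j. (1::real) / 2 ^ (j + 1)) sums 1"
    by (simp add: power_one_over)
  have "binary_value b t \<le> (\<Sum>j. 1 / 2 ^ (j + 1))"
    unfolding binary_value_def
    by (intro suminf_le summable_bits sums_summable[OF S]) (simp add: b01 divide_right_mono)
  then show "binary_value b t \<le> 1" using sums_unique[OF S] by simp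
qed

lemma binary_value_split:
  "binary_value b t = leading_part h b t + binary_value b (t - int h) / 2 ^ h"
proof -
  have "binary_value b t = (\<Sum>j. b (t - int (j + h)) / 2 ^ (j + h + 1)) + leading_part h b t"
    unfolding binary_value_def leading_part_def
    by (rule suminf_split_initial_segment[OF summable_bits])
  also have "(\<Sum>j. b (t - int (j + h)) / 2 ^ (j + h + 1))
      = (\<Sum>j. (b ((t - int h) - int j) / 2 ^ (j + 1)) / 2 ^ h)"
    by (simp add: power_add algebra_simps)
  also have "\<dots> = binary_value b (t - int h) / 2 ^ h"
    unfolding binary_value_def by (rule suminf_divide[OF summable_bits])
  finally show ?thesis by simp
qed

text \<open>Multiplication by \<open>2 ^ h\<close> moves the first \<open>h\<close> digits in front of the binary point.\<close>

lemma leading_part_integral: "2 ^ h * leading_part h b t \<in> \<int>"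
proof -
  have "2 ^ h * (b (t - int j) / 2 ^ (j + 1)) \<in> \<int>" if "j < h" for j
  proof -
    have "2 ^ h * (b (t - int j) / 2 ^ (j + 1)) = 2 ^ (h - (j + 1)) * b (t - int j)"
      using that by (simp add: power_diff)
    moreover have "b (t - int j) \<in> \<int>" using bits[of "t - int j"] by auto
    ultimately show ?thesis by simp
  qed
  then show ?thesis
    unfolding leading_part_def sum_distrib_left by (intro Ints_sum) auto
qed

text \<open>
  Fractional parts avoid any discussion of numbers with two binary expansions: no digit has to be
  recovered, so the identity holds for every sequence of bits.
\<close>

lemma frac_binary_value: "frac (2 ^ h * binary_value b t) = frac (binary_value b (t - int h))"
proof -
  have "2 ^ h * binary_value b t = 2 ^ h * leading_part h b t + binary_value b (t - int h)"
    by (subst binary_value_split[of t h]) (simp add: algebra_simps)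
  then show ?thesis by (simp add: frac_add_int_left leading_part_integral)
qed

end

section \<open>Covariances and Lipschitz functions\<close>

text \<open>
  Since \<open>W\<close> is independent of \<open>Y\<close>, it is uncorrelated with the centred variable \<open>Y - E Y\<close>.
  Subtracting it from \<open>Z\<close> therefore leaves the covariance unchanged, and what remains is an integral
  of \<open>Y - E Y\<close>, at most \<open>2 * c\<close>, against \<open>Z - W\<close>, at most \<open>d\<close>.
\<close>

lemma (in prob_space) covariance_le_of_indep_approx:
  assumes [measurable]: "Y \<in> borel_measurable M" "Z \<in> borel_measurable M"
    and indep: "indep_var borel Y borel W"
    and Y: "\<And>\<omega>. \<omega> \<in> space M \<Longrightarrow> \<bar>Y \<omega>\<bar> \<le> c"
    and Z: "\<And>\<omega>. \<omega> \<in> space M \<Longrightarrow> \<bar>Z \<omega>\<bar> \<le> C"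
    and W: "\<And>\<omega>. \<omega> \<in> space M \<Longrightarrow> \<bar>W \<omega>\<bar> \<le> C"
    and ZW: "AE \<omega> in M. \<bar>Z \<omega> - W \<omega>\<bar> \<le> d"
  shows "\<bar>covariance M Y Z\<bar> \<le> 2 * c * d"
proof -
  have [measurable]: "W \<in> borel_measurable M"
    using indep by (rule indep_var_rv2)
  have iY: "integrable M Y" using Y by (intro integrable_const_bound[where B=c]) auto
  have iZ: "integrable M Z" using Z by (intro integrable_const_bound[where B=C]) auto
  have iW: "integrable M W" using W by (intro integrable_const_bound[where B=C]) auto
  obtain \<omega>0 where \<omega>0: "\<omega>0 \<in> space M" using not_empty by blast
  have c0: "0 \<le> c" using Y[OF \<omega>0] by linarith
  define m where "m = expectation Y"
  have m: "\<bar>m\<bar> \<le> c"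
  proof -
    have "\<bar>m\<bar> \<le> expectation (\<lambda>\<omega>. \<bar>Y \<omega>\<bar>)" unfolding m_def by (rule integral_abs_bound)
    also have "\<dots> \<le> expectation (\<lambda>_. c)"
      using Y iY by (intro integral_mono) auto
    finally show ?thesis by (simp add: prob_space)
  qed
  have Ym: "\<bar>Y \<omega> - m\<bar> \<le> 2 * c" if "\<omega> \<in> space M" for \<omega>
    using Y[OF that] m by linarith
  have iYZ: "integrable M (\<lambda>\<omega>. (Y \<omega> - m) * Z \<omega>)"
    using Ym Z c0 by (intro integrable_const_bound[where B="2*c*C"]) (auto simp: abs_mult intro!: mult_mono)
  have iYW: "integrable M (\<lambda>\<omega>. (Y \<omega> - m) * W \<omega>)"
    using Ym W c0 by (intro integrable_const_bound[where B="2*c*C"]) (auto simp: abs_mult intro!: mult_mono)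
  have Ym0: "expectation (\<lambda>\<omega>. Y \<omega> - m) = 0"
    using iY by (simp add: m_def prob_space)
  have "indep_var borel ((\<lambda>y. y - m) \<circ> Y) borel ((\<lambda>w. w) \<circ> W)"
    by (rule indep_var_compose[OF indep]) auto
  then have "indep_var borel (\<lambda>\<omega>. Y \<omega> - m) borel W" by (simp add: comp_def)
  then have W0: "expectation (\<lambda>\<omega>. (Y \<omega> - m) * W \<omega>) = 0"
    using indep_var_lebesgue_integral[of "\<lambda>\<omega>. Y \<omega> - m" W] iY iW Ym0 by simp
  have "covariance M Y Z = expectation (\<lambda>\<omega>. (Y \<omega> - m) * Z \<omega> - (Y \<omega> - m) * expectation Z)"
    unfolding covariance_def m_def by (simp add: algebra_simps)
  also have "\<dots> = expectation (\<lambda>\<omega>. (Y \<omega> - m) * Z \<omega>)"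
    using iYZ iY Ym0 by (subst Bochner_Integration.integral_diff) auto
  also have "\<dots> = expectation (\<lambda>\<omega>. (Y \<omega> - m) * Z \<omega> - (Y \<omega> - m) * W \<omega>)"
    using iYZ iYW W0 by (subst Bochner_Integration.integral_diff) auto
  also have "\<bar>\<dots>\<bar> \<le> expectation (\<lambda>\<omega>. \<bar>(Y \<omega> - m) * Z \<omega> - (Y \<omega> - m) * W \<omega>\<bar>)"
    by (rule integral_abs_bound)
  also have "\<dots> \<le> expectation (\<lambda>_. 2 * c * d)"
  proof (rule integral_mono_AE)
    show "integrable M (\<lambda>\<omega>. \<bar>(Y \<omega> - m) * Z \<omega> - (Y \<omega> - m) * W \<omega>\<bar>)"
      using iYZ iYW by auto
    show "AE \<omega> in M. \<bar>(Y \<omega> - m) * Z \<omega> - (Y \<omega> - m) * W \<omega>\<bar> \<le> 2 * c * d"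
      using ZW AE_space
    proof eventually_elim
      case (elim \<omega>)
      have "\<bar>Y \<omega> - m\<bar> * \<bar>Z \<omega> - W \<omega>\<bar> \<le> 2 * c * d"
        using elim Ym c0 by (intro mult_mono) auto
      then show ?case by (simp flip: right_diff_distrib add: abs_mult)
    qed
  qed auto
  finally show ?thesis by (simp add: prob_space)
qed

text \<open>
  \<^const>\<open>Lip\<close> and \<^const>\<open>sup_norm\<close> are suprema of reals, so they bound their members only once
  boundedness of the underlying sets is known.
\<close>

lemma bdd_above_difference_quotients:
  assumes "L-lipschitz_on UNIV G"
  shows "bdd_above {\<bar>G x - G y\<bar> / \<bar>x - y\<bar> | x y. x \<noteq> (y::real)}"
proof (rule bdd_aboveI[of _ L])
  fix q assume "q \<in> {\<bar>G x - G y\<bar> / \<bar>x - y\<bar> | x y. x \<noteq> y}"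
  then obtain x y where "x \<noteq> y" "q = \<bar>G x - G y\<bar> / \<bar>x - y\<bar>" by blast
  then show "q \<le> L" using lipschitz_onD[OF assms, of x y]
    by (simp add: dist_real_def divide_le_eq)
qed

lemma Lip_bound:
  assumes "G \<in> bounded_lipschitz"
  shows "\<bar>G x - G y\<bar> \<le> Lip G * \<bar>x - y\<bar>"
proof (cases "x = y")
  case False
  obtain L where "L-lipschitz_on UNIV G" using assms by (auto simp: bounded_lipschitz_def)
  then have "\<bar>G x - G y\<bar> / \<bar>x - y\<bar> \<le> Lip G"
    unfolding Lip_def using False by (intro cSup_upper bdd_above_difference_quotients) blast+
  then show ?thesis using False by (simp add: divide_le_eq)
qed simp

lemma sup_norm_upper:
  assumes "F \<in> bounded_borel u" "x \<in> space (tuple_space u)"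
  shows "\<bar>F x\<bar> \<le> sup_norm u F"
proof -
  have "bounded (F ` space (tuple_space u))" using assms by (simp add: bounded_borel_def)
  then obtain B where "\<And>y. y \<in> space (tuple_space u) \<Longrightarrow> \<bar>F y\<bar> \<le> B"
    by (auto simp: bounded_iff)
  then show ?thesis
    unfolding sup_norm_def by (intro cSUP_upper bdd_aboveI2[of _ _ B] assms)
qed

section \<open>Lower bounds for mixing coefficients\<close>

lemma (in prob_space) alpha_deviation_le_1: "\<bar>prob A * prob B - prob (A \<inter> B)\<bar> \<le> 1"
proof -
  have "0 \<le> prob A * prob B" "prob A * prob B \<le> 1" by (auto intro: mult_le_one)
  moreover have "0 \<le> prob (A \<inter> B)" "prob (A \<inter> B) \<le> 1" by auto
  ultimately show ?thesis by linarith
qed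

lemma (in prob_space) alpha_coeff_lower:
  assumes "A \<in> \<A>" "B \<in> \<B>"
  shows "\<bar>prob A * prob B - prob (A \<inter> B)\<bar> \<le> alpha_coeff M \<A> \<B>"
  unfolding alpha_coeff_def using assms
  by (intro cSup_upper bdd_aboveI[of _ 1]) (auto intro: alpha_deviation_le_1)

lemma (in prob_space) alpha_coeff_le_1:
  assumes "\<A> \<noteq> {}" "\<B> \<noteq> {}"
  shows "alpha_coeff M \<A> \<B> \<le> 1"
  unfolding alpha_coeff_def using assms
  by (intro cSup_least) (auto intro: alpha_deviation_le_1)

lemma generated_events_nonempty: "generated_events M X S \<noteq> {}"
  unfolding generated_events_def using sigma_sets.Empty by blast

lemma generated_eventsI:
  assumes "s \<in> S" "B \<in> sets borel"
  shows "X s -` B \<inter> space M \<in> generated_events M X S"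
  unfolding generated_events_def using assms by blast

lemma (in prob_space) alpha_inf_1_coeff_lower:
  assumes "finite T" "card T \<le> 1" "index_dist S T \<ge> enat h"
  shows "alpha_coeff M (generated_events M X S) (generated_events M X T) \<le> alpha_inf_1_coeff M X h"
  unfolding alpha_inf_1_coeff_def using assms
  by (intro cSup_upper bdd_aboveI[of _ 1]) (auto intro!: alpha_coeff_le_1 generated_events_nonempty)

text \<open>
  An event is as dependent on itself as possible: for \<open>A = B\<close> up to a null set the deviation is
  \<open>P(A) * (1 - P(A))\<close>, and both factors are at least \<open>p\<close>.
\<close>

lemma (in prob_space) square_le_self_deviation:
  assumes "p \<le> prob A" "prob A \<le> 1 - p" "0 \<le> p"
    and "A \<in> events" "B \<in> events" "AE \<omega> in M. \<omega> \<in> A \<longleftrightarrow> \<omega> \<in> B"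
  shows "p\<^sup>2 \<le> \<bar>prob A * prob B - prob (A \<inter> B)\<bar>"
proof -
  have "prob B = prob A" "prob (A \<inter> B) = prob A"
    using assms(4-6) by (auto intro!: finite_measure_eq_AE)
  moreover have "p * p \<le> prob A * (1 - prob A)"
    using assms by (intro mult_mono) auto
  ultimately show ?thesis by (simp add: power2_eq_square algebra_simps)
qed


section \<open>Averages of independent fair bits\<close>

locale fair_bits = prob_space M for M :: "'a measure" +
  fixes \<xi> :: "int \<Rightarrow> 'a \<Rightarrow> real"
  assumes indep_bits: "indep_vars (\<lambda>_. borel) \<xi> UNIV"
    and distr_bit: "\<And>k. distr M borel (\<xi> k) = distr (measure_pmf (bernoulli_pmf (1/2))) borel of_bool"
begin

definition X :: "int \<Rightarrow> 'a \<Rightarrow> real" where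
  "X t \<omega> = binary_value (\<lambda>k. \<xi> k \<omega>) t"

lemma measurable_bit [measurable]: "\<xi> k \<in> borel_measurable M"
  using indep_bits by (simp add: indep_vars_def)

lemma measurable_X [measurable]: "X t \<in> borel_measurable M"
  unfolding X_def binary_value_def by measurable

lemma AE_bits: "AE \<omega> in M. \<forall>k. \<xi> k \<omega> \<in> {0, 1}"
proof -
  have "AE \<omega> in M. \<xi> k \<omega> \<in> {0, 1}" for k
  proof -
    have "AE x in distr (measure_pmf (bernoulli_pmf (1/2))) borel of_bool. x \<in> {0, 1::real}"
      by (subst AE_distr_iff) auto
    then have "AE x in distr M borel (\<xi> k). x \<in> {0, 1}" by (simp only: distr_bit)
    then show ?thesis by (subst (asm) AE_distr_iff) auto
  qed
  then show ?thesis by (simp add: AE_all_countable)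
qed

lemma prob_bit: "prob (\<xi> k -` {of_bool c} \<inter> space M) = 1/2"
proof -
  have "prob (\<xi> k -` {of_bool c} \<inter> space M) = measure (distr M borel (\<xi> k)) {of_bool c}"
    by (rule measure_distr[symmetric]) auto
  also have "\<dots> = measure_pmf.prob (bernoulli_pmf (1/2)) (of_bool -` {of_bool c :: real})"
    unfolding distr_bit by (subst measure_distr) auto
  also have "of_bool -` {of_bool c :: real} = {c}" by auto
  finally show ?thesis by (cases c) (simp_all add: measure_pmf_single)
qed

lemma prob_two_bits:
  assumes "k \<noteq> l"
  shows "prob {\<omega> \<in> space M. \<xi> k \<omega> = of_bool c \<and> \<xi> l \<omega> = of_bool d} = 1/4"
proof -
  define A where "A i = {of_bool (if i = k then c else d) :: real}" for i
  have "{\<omega> \<in> space M. \<xi> k \<omega> = of_bool c \<and> \<xi> l \<omega> = of_bool d} = (\<Inter>i\<in>{k,l}. \<xi> i -` A i \<inter> space M)"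
    using assms by (auto simp: A_def)
  also have "prob \<dots> = (\<Prod>i\<in>{k,l}. prob (\<xi> i -` A i \<inter> space M))"
    by (rule indep_varsD[OF indep_bits]) (auto simp: A_def)
  also have "\<dots> = 1/4" using assms by (simp add: A_def prob_bit)
  finally show ?thesis .
qed

text \<open>
  The marginal law of \<open>X\<close> over the times \<open>I + k\<close> is the image of the digit law \<open>P\<close> under a shift by
  \<open>k\<close> followed by the map \<open>V\<close> that evaluates expansions at the times \<open>I\<close>; the shift preserves
  \<open>P\<close>.
\<close>

lemma strictly_stationary_X: "strictly_stationary M X"
  unfolding strictly_stationary_def
proof (intro conjI allI impI)
  fix I :: "int set" and k :: int
  assume "finite I"
  define D where "D = distr (measure_pmf (bernoulli_pmf (1/2))) borel (of_bool :: bool \<Rightarrow> real)"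
  have prob_D: "prob_space D"
    unfolding D_def by (rule prob_space.prob_space_distr) (auto intro: measure_pmf.prob_space_axioms)
  have sets_D: "sets D = sets borel" by (simp add: D_def)
  define P where "P = (\<Pi>\<^sub>M i\<in>(UNIV :: int set). D)"
  have sets_P: "sets P = sets (\<Pi>\<^sub>M i\<in>(UNIV :: int set). (borel :: real measure))"
    unfolding P_def by (intro sets_PiM_cong sets_D refl)
  have joint: "distr M (\<Pi>\<^sub>M i\<in>UNIV. borel) (\<lambda>\<omega> i. \<xi> i \<omega>) = P"
    using indep_bits indep_vars_iff_distr_eq_PiM[of UNIV \<xi> "\<lambda>_. borel"]
    by (simp add: P_def D_def distr_bit restrict_def)
  have shift: "distr P P (\<lambda>x i. x (i + k)) = P"
    using distr_PiM_reindex[of UNIV "\<lambda>_. D" "\<lambda>i. i + k" UNIV] prob_D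
    by (simp add: P_def inj_on_def restrict_def)
  define V where "V = (\<lambda>x. \<lambda>i\<in>I. binary_value x i)"
  have [measurable]: "V \<in> measurable P (\<Pi>\<^sub>M i\<in>I. borel)"
    unfolding V_def measurable_cong_sets[OF sets_P refl]
    by (intro measurable_restrict measurable_binary_value) simp
  have [measurable]: "(\<lambda>x i. x (i + k)) \<in> measurable P P"
    unfolding measurable_cong_sets[OF sets_P sets_P]
    by (rule measurable_PiM_single') auto
  have bits_P [measurable]: "(\<lambda>\<omega> i. \<xi> (i + l) \<omega>) \<in> measurable M P" for l
    unfolding measurable_cong_sets[OF refl sets_P]
    by (rule measurable_PiM_single') auto
  have [measurable]: "(\<lambda>\<omega> i. \<xi> i \<omega>) \<in> measurable M P"
    using bits_P[of 0] by simp
  have joint': "distr M P (\<lambda>\<omega> i. \<xi> i \<omega>) = P"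
    using joint by (simp add: distr_cong[OF refl sets_P refl])
  have V_bits: "V (\<lambda>i. \<xi> (i + l) \<omega>) = (\<lambda>i\<in>I. X (i + l) \<omega>)" for l \<omega>
    using binary_value_shift[of "\<lambda>i. \<xi> i \<omega>" l] by (simp add: V_def X_def fun_eq_iff)
  have "distr M (\<Pi>\<^sub>M i\<in>I. borel) (\<lambda>\<omega>. \<lambda>i\<in>I. X (i + k) \<omega>)
      = distr (distr (distr M P (\<lambda>\<omega> i. \<xi> i \<omega>)) P (\<lambda>x i. x (i + k))) (\<Pi>\<^sub>M i\<in>I. borel) V"
    by (simp add: distr_distr comp_def V_bits)
  also have "\<dots> = distr (distr M P (\<lambda>\<omega> i. \<xi> i \<omega>)) (\<Pi>\<^sub>M i\<in>I. borel) V"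
    by (simp only: joint' shift)
  also have "\<dots> = distr M (\<Pi>\<^sub>M i\<in>I. borel) (\<lambda>\<omega>. \<lambda>i\<in>I. X i \<omega>)"
    using V_bits[of 0] by (simp add: distr_distr comp_def)
  finally show "distr M (\<Pi>\<^sub>M i\<in>I. borel) (\<lambda>\<omega>. \<lambda>i\<in>I. X (i + k) \<omega>)
      = distr M (\<Pi>\<^sub>M i\<in>I. borel) (\<lambda>\<omega>. \<lambda>i\<in>I. X i \<omega>)" .
qed simp

text \<open>
  The values of \<open>X\<close> at times in \<^term>\<open>past_set j h\<close> read the digits up to \<open>j - h\<close>, the leading part
  at time \<open>j\<close> reads those after \<open>j - h\<close>. Both are rewritten as functions of the restrictions of the
  digit sequence to these disjoint index sets. This works at every sample point, including those
  where the series diverges, because equal digits give equal (possibly meaningless) values.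
\<close>

lemma indep_past_leading_part:
  assumes F: "F \<in> borel_measurable (tuple_space (length \<Gamma>))" and \<Gamma>: "set \<Gamma> \<subseteq> past_set j h"
  shows "indep_var borel (\<lambda>\<omega>. F (subvector X \<Gamma> \<omega>)) borel (\<lambda>\<omega>. leading_part h (\<lambda>k. \<xi> k \<omega>) j)"
proof -
  define A where "A = {..j - int h}"
  define B where "B = {j - int h<..j}"
  define F' where "F' x = F (subvector (\<lambda>t x. binary_value x t) \<Gamma> x)" for x
  have le: "\<Gamma> ! k \<le> j - int h" if "k < length \<Gamma>" for k
    using \<Gamma> nth_mem[OF that] by (auto simp: past_set_def)
  have "indep_var (\<Pi>\<^sub>M k\<in>A. borel) (\<lambda>\<omega>. \<lambda>k\<in>A. \<xi> k \<omega>) (\<Pi>\<^sub>M k\<in>B. borel) (\<lambda>\<omega>. \<lambda>k\<in>B. \<xi> k \<omega>)"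
    by (rule indep_var_restrict[OF indep_bits]) (auto simp: A_def B_def)
  moreover have "(\<lambda>x. subvector (\<lambda>t x. binary_value x t) \<Gamma> x)
      \<in> measurable (\<Pi>\<^sub>M k\<in>A. borel) (tuple_space (length \<Gamma>))"
    unfolding subvector_def
    by (intro measurable_restrict measurable_binary_value) (auto simp: A_def dest: le)
  then have "F' \<in> borel_measurable (\<Pi>\<^sub>M k\<in>A. borel)"
    unfolding F'_def using F by (rule measurable_compose)
  moreover have "(\<lambda>x. leading_part h x j) \<in> borel_measurable (\<Pi>\<^sub>M k\<in>B. borel)"
    by (rule measurable_leading_part) (simp add: B_def)
  ultimately have "indep_var borel (F' \<circ> (\<lambda>\<omega>. \<lambda>k\<in>A. \<xi> k \<omega>))
      borel ((\<lambda>x. leading_part h x j) \<circ> (\<lambda>\<omega>. \<lambda>k\<in>B. \<xi> k \<omega>))"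
    by (rule indep_var_compose)
  moreover have "F' (\<lambda>k\<in>A. \<xi> k \<omega>) = F (subvector X \<Gamma> \<omega>)" for \<omega>
  proof -
    have "binary_value (\<lambda>k\<in>A. \<xi> k \<omega>) (\<Gamma> ! i) = X (\<Gamma> ! i) \<omega>" if "i < length \<Gamma>" for i
      unfolding X_def using le[OF that] by (intro binary_value_cong) (simp add: A_def)
    then have "subvector (\<lambda>t x. binary_value x t) \<Gamma> (\<lambda>k\<in>A. \<xi> k \<omega>) = subvector X \<Gamma> \<omega>"
      by (auto simp: subvector_def restrict_def)
    then show ?thesis by (simp add: F'_def)
  qed
  moreover have "leading_part h (\<lambda>k\<in>B. \<xi> k \<omega>) j = leading_part h (\<lambda>k. \<xi> k \<omega>) j" for \<omega>
    by (rule leading_part_cong) (simp add: B_def)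
  ultimately show ?thesis by (simp add: comp_def)
qed

text \<open>
  The independent substitute for \<open>G (X j \<omega>)\<close> is \<open>G\<close> of the first \<open>h\<close> digits of \<open>X j \<omega>\<close>; the
  neglected tail is at most \<open>1 / 2 ^ h\<close>.
\<close>

lemma covariance_past_le:
  assumes F: "F \<in> bounded_borel u" and G: "G \<in> bounded_lipschitz"
    and \<Gamma>: "length \<Gamma> = u" "set \<Gamma> \<subseteq> past_set j h"
  shows "\<bar>covariance M (\<lambda>\<omega>. F (subvector X \<Gamma> \<omega>)) (\<lambda>\<omega>. G (X j \<omega>))\<bar>
    \<le> 2 * sup_norm u F * (Lip G / 2 ^ h)"
proof -
  obtain C where C: "\<And>x. \<bar>G x\<bar> \<le> C"
    using G by (auto simp: bounded_lipschitz_def bounded_iff)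
  obtain L where "L-lipschitz_on UNIV G" using G by (auto simp: bounded_lipschitz_def)
  then have [measurable]: "G \<in> borel_measurable borel"
    by (intro borel_measurable_continuous_onI lipschitz_on_continuous_on)
  have F_meas: "F \<in> borel_measurable (tuple_space (length \<Gamma>))"
    using F \<Gamma> by (simp add: bounded_borel_def)
  have "subvector X \<Gamma> \<in> measurable M (tuple_space (length \<Gamma>))"
    unfolding subvector_def[abs_def] by measurable
  then have Y_meas: "(\<lambda>\<omega>. F (subvector X \<Gamma> \<omega>)) \<in> borel_measurable M"
    using F_meas by (rule measurable_compose)
  have "indep_var borel ((\<lambda>y. y) \<circ> (\<lambda>\<omega>. F (subvector X \<Gamma> \<omega>)))
      borel (G \<circ> (\<lambda>\<omega>. leading_part h (\<lambda>k. \<xi> k \<omega>) j))"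
    by (rule indep_var_compose[OF indep_past_leading_part[OF F_meas \<Gamma>(2)]]) auto
  then have indep: "indep_var borel (\<lambda>\<omega>. F (subvector X \<Gamma> \<omega>))
      borel (\<lambda>\<omega>. G (leading_part h (\<lambda>k. \<xi> k \<omega>) j))"
    by (simp add: comp_def)
  show ?thesis
  proof (rule covariance_le_of_indep_approx[OF Y_meas _ indep, where C=C])
    show "\<bar>F (subvector X \<Gamma> \<omega>)\<bar> \<le> sup_norm u F" for \<omega>
      by (rule sup_norm_upper[OF F]) (simp add: \<Gamma>(1) subvector_def space_PiM)
    show "AE \<omega> in M. \<bar>G (X j \<omega>) - G (leading_part h (\<lambda>k. \<xi> k \<omega>) j)\<bar> \<le> Lip G / 2 ^ h"
      using AE_bits
    proof eventually_elim
      case (elim \<omega>)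
      define b where "b k = \<xi> k \<omega>" for k
      have bits: "b k \<in> {0, 1}" for k using elim by (simp add: b_def)
      have "Lip G \<ge> 0" using Lip_bound[OF G, of 0 1] by simp
      have "\<bar>G (X j \<omega>) - G (leading_part h b j)\<bar> \<le> Lip G * \<bar>X j \<omega> - leading_part h b j\<bar>"
        by (rule Lip_bound[OF G])
      also have "X j \<omega> - leading_part h b j = binary_value b (j - int h) / 2 ^ h"
        using binary_value_split[of b, OF bits, of j h] by (simp add: X_def b_def[abs_def])
      also have "Lip G * \<bar>\<dots>\<bar> \<le> Lip G * (1 / 2 ^ h)"
        using binary_value_bounds[of b, OF bits, of "j - int h"] \<open>Lip G \<ge> 0\<close>
        by (intro mult_left_mono) (simp_all add: divide_right_mono)
      finally show ?case by (simp add: b_def[abs_def])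
    qed
  qed (auto simp: C)
qed

lemma theta_le: "theta M X h \<le> ennreal (2 * (1/2) ^ h)"
  unfolding theta_def theta_tuple_def
proof (intro SUP_least Sup_least, safe)
  fix F :: "(nat \<Rightarrow> real) \<Rightarrow> real" and G j and \<Gamma> :: "int list"
  assume *: "F \<in> bounded_borel (length \<Gamma>)" "G \<in> bounded_lipschitz" "set \<Gamma> \<subseteq> past_set j h"
    "sup_norm (length \<Gamma>) F * Lip G \<noteq> 0"
  let ?u = "length \<Gamma>"
  have "0 \<le> Lip G" using Lip_bound[OF *(2), of 0 1] by simp
  moreover have "0 \<le> sup_norm ?u F"
    using sup_norm_upper[OF *(1), of "\<lambda>i\<in>{..<?u}. 0"] by (simp add: space_PiM)
  ultimately have "0 < sup_norm ?u F * Lip G" using *(4) by (simp add: less_le)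
  then show "ennreal (\<bar>covariance M (\<lambda>\<omega>. F (subvector X \<Gamma> \<omega>)) (\<lambda>\<omega>. G (X j \<omega>))\<bar>
       / (sup_norm ?u F * Lip G)) \<le> ennreal (2 * (1/2) ^ h)"
    using covariance_past_le[OF *(1,2) refl *(3)]
    by (intro ennreal_leI) (simp add: pos_divide_le_eq power_one_over field_simps)
qed

lemma theta_lex_weakly_dependent_X: "theta_lex_weakly_dependent M X"
  unfolding theta_lex_weakly_dependent_def
proof (rule tendsto_sandwich[OF _ _ tendsto_const])
  have "(\<lambda>h. 2 * (1/2::real) ^ h) \<longlonglongrightarrow> 2 * 0"
    by (intro tendsto_intros LIMSEQ_power_zero) simp
  then show "(\<lambda>h. ennreal (2 * (1/2) ^ h)) \<longlonglongrightarrow> 0"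
    using tendsto_ennrealI by fastforce
qed (auto simp: theta_le)

text \<open>
  The event is \<open>frac (X 0) \<in> [1/4, 1/2]\<close>, which almost surely equals
  \<open>frac (2 ^ h * X h) \<in> [1/4, 1/2]\<close>. Closed intervals of expansions make its probability easy to
  bound without computing it: leading digits \<open>01\<close> force \<open>X 0\<close> into \<open>[1/4, 1/2]\<close>, and leading
  digits \<open>11\<close> force it into \<open>[3/4, 1]\<close>, whose fractional parts lie in \<open>[3/4, 1)\<close> or are \<open>0\<close>.
  So the event and its complement have probability at least \<open>1/4\<close> each, whence the bound \<open>(1/4)\<^sup>2\<close>.
\<close>

lemma exists_common_event:
  "\<exists>A\<in>generated_events M X {0}. \<exists>B\<in>generated_events M X {int h}.
     1/16 \<le> \<bar>prob A * prob B - prob (A \<inter> B)\<bar>"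
proof -
  define D where "D n = {x :: real. frac (2 ^ n * x) \<in> {1/4..1/2}}" for n :: nat
  have D_borel: "D n \<in> sets borel" for n
    unfolding D_def frac_def atLeastAtMost_iff by measurable
  define A where "A = X 0 -` D 0 \<inter> space M"
  define B where "B = X (int h) -` D h \<inter> space M"
  have gen: "A \<in> generated_events M X {0}" "B \<in> generated_events M X {int h}"
    unfolding A_def B_def by (auto intro: generated_eventsI D_borel)
  have [measurable]: "A \<in> events" "B \<in> events"
    unfolding A_def B_def by (auto intro!: measurable_sets[OF measurable_X] D_borel)
  have AB: "AE \<omega> in M. \<omega> \<in> A \<longleftrightarrow> \<omega> \<in> B"
    using AE_bits
  proof eventually_elim
    case (elim \<omega>)
    then show ?case
      using frac_binary_value[of "\<lambda>k. \<xi> k \<omega>" h "int h"] by (simp add: A_def B_def D_def X_def)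
  qed
  define E where "E c d = {\<omega> \<in> space M. \<xi> 0 \<omega> = of_bool c \<and> \<xi> (-1) \<omega> = of_bool d}" for c d
  have [measurable]: "E c d \<in> events" for c d
    unfolding E_def by measurable
  have X0: "X 0 \<omega> = \<xi> 0 \<omega> / 2 + \<xi> (-1) \<omega> / 4 + binary_value (\<lambda>k. \<xi> k \<omega>) (-2) / 4"
    if "\<forall>k. \<xi> k \<omega> \<in> {0, 1}" for \<omega>
    using binary_value_split[of "\<lambda>k. \<xi> k \<omega>" 0 2] that
    by (simp add: X_def leading_part_def numeral_2_eq_2)
  have "AE \<omega> in M. \<omega> \<in> E False True \<longrightarrow> \<omega> \<in> A"
    using AE_bits
  proof eventually_elim
    case (elim \<omega>)
    show ?case
    proof
      assume \<omega>: "\<omega> \<in> E False True"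
      then have "X 0 \<omega> \<in> {1/4..1/2}"
        using X0[OF elim] binary_value_bounds[of "\<lambda>k. \<xi> k \<omega>" "-2"] elim by (auto simp: E_def)
      moreover from this have "frac (X 0 \<omega>) = X 0 \<omega>" by (simp add: frac_eq)
      ultimately show "\<omega> \<in> A" using \<omega> by (simp add: A_def D_def E_def)
    qed
  qed
  then have "prob (E False True) \<le> prob A" by (rule finite_measure_mono_AE) measurable
  then have lower: "1/4 \<le> prob A"
    using prob_two_bits[of 0 "-1" False True] by (simp add: E_def)
  have "AE \<omega> in M. \<omega> \<in> E True True \<longrightarrow> \<omega> \<in> space M - A"
    using AE_bits
  proof eventually_elim
    case (elim \<omega>)
    show ?case
    proof
      assume \<omega>: "\<omega> \<in> E True True"
      then have "3/4 \<le> X 0 \<omega>" "X 0 \<omega> \<le> 1"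
        using X0[OF elim] binary_value_bounds[of "\<lambda>k. \<xi> k \<omega>" "-2"] elim by (auto simp: E_def)
      \<comment> \<open>all digits may be \<open>1\<close>, and then the fractional part wraps around to \<open>0\<close>\<close>
      then have "frac (X 0 \<omega>) = (if X 0 \<omega> = 1 then 0 else X 0 \<omega>)"
        by (simp add: frac_unique_iff)
      then have "X 0 \<omega> \<notin> D 0" using \<open>3/4 \<le> X 0 \<omega>\<close> by (auto simp: D_def split: if_splits)
      then show "\<omega> \<in> space M - A" using \<omega> by (simp add: A_def E_def)
    qed
  qed
  then have "prob (E True True) \<le> prob (space M - A)" by (rule finite_measure_mono_AE) measurable
  then have upper: "prob A \<le> 1 - 1/4"
    using prob_two_bits[of 0 "-1" True True] by (simp add: E_def prob_compl)
  have "(1/4)\<^sup>2 \<le> \<bar>prob A * prob B - prob (A \<inter> B)\<bar>"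
    by (rule square_le_self_deviation[OF lower upper]) (use AB in auto)
  then show ?thesis using gen by (auto simp: power2_eq_square)
qed

lemma generated_events_mono: "S \<subseteq> T \<Longrightarrow> generated_events M X S \<subseteq> generated_events M X T"
  unfolding generated_events_def by (intro sigma_sets_mono') blast

lemma alpha_coeff_ge:
  assumes "0 \<in> S" "int h \<in> T"
  shows "1/16 \<le> alpha_coeff M (generated_events M X S) (generated_events M X T)"
proof -
  obtain A B where AB: "A \<in> generated_events M X {0}" "B \<in> generated_events M X {int h}"
    and dev: "1/16 \<le> \<bar>prob A * prob B - prob (A \<inter> B)\<bar>"
    using exists_common_event by blast
  have "A \<in> generated_events M X S" "B \<in> generated_events M X T"
    using AB generated_events_mono[of "{0}" S] generated_events_mono[of "{int h}" T] assms by auto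
  from alpha_coeff_lower[OF this] dev show ?thesis by linarith
qed

lemma not_alpha_mixing_X: "\<not> alpha_mixing M X"
proof
  assume "alpha_mixing M X"
  then have "alpha_mixing_coeff M X \<longlonglongrightarrow> 0" by (simp add: alpha_mixing_def)
  moreover have "1/16 \<le> alpha_mixing_coeff M X h" for h
    unfolding alpha_mixing_coeff_def by (rule alpha_coeff_ge) auto
  ultimately have "1/16 \<le> (0::real)" by (intro LIMSEQ_le_const) auto
  then show False by simp
qed

lemma not_alpha_inf_1_mixing_X: "\<not> alpha_inf_1_mixing M X"
proof
  assume "alpha_inf_1_mixing M X"
  then have "alpha_inf_1_coeff M X \<longlonglongrightarrow> 0" by (simp add: alpha_inf_1_mixing_def)
  moreover have "1/16 \<le> alpha_inf_1_coeff M X h" for h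
  proof -
    have "1/16 \<le> alpha_coeff M (generated_events M X {0}) (generated_events M X {int h})"
      by (rule alpha_coeff_ge) auto
    also have "\<dots> \<le> alpha_inf_1_coeff M X h"
      by (rule alpha_inf_1_coeff_lower) (auto simp: index_dist_def)
    finally show ?thesis .
  qed
  ultimately have "1/16 \<le> (0::real)" by (intro LIMSEQ_le_const) auto
  then show False by simp
qed

end

theorem proposition2p7:
  fixes M :: "'a measure" and \<xi> X :: "int \<Rightarrow> 'a \<Rightarrow> real"
  assumes "prob_space M"
    and "prob_space.indep_vars M (\<lambda>_. borel) \<xi> UNIV"
    and "\<And>k. distr M borel (\<xi> k) = distr (measure_pmf (bernoulli_pmf (1/2))) borel of_bool"
    and "\<And>t \<omega>. X t \<omega> = (\<Sum>j. \<xi> (t - int j) \<omega> / 2 ^ (j + 1))"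
  shows "strictly_stationary M X \<and> theta_lex_weakly_dependent M X \<and>
         \<not> alpha_mixing M X \<and> \<not> alpha_inf_1_mixing M X"
proof -
  interpret prob_space M by fact
  interpret bits: fair_bits M \<xi> by unfold_locales (use assms in auto)
  have "X = bits.X" using assms(4) by (simp add: fun_eq_iff bits.X_def binary_value_def)
  then show ?thesis
    using bits.strictly_stationary_X bits.theta_lex_weakly_dependent_X
      bits.not_alpha_mixing_X bits.not_alpha_inf_1_mixing_X by simp
qed

end
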